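(* Let $f:[0,\infty)\to\mathbb{R}$ be a non-negative, strictly increasing, convex function with $f(0)=0$. Let $A,B$ be $n\times n$ complex positive semidefinite matrices such that $A\ge \|B\|_\infty\,\mathbf{I}$. Then $\lambda_k^\downarrow(f(A-B)) \le \lambda_k^\downarrow(f(A)-f(B))$ for all $k=1,\dots,n$.
   Context: For Hermitian matrices, $X\ge Y$ means $X-Y$ is positive semidefinite. $\mathbf{I}$ is the identity matrix and $\|B\|_\infty$ is the operator (spectral) norm. For a Hermitian matrix $X$, $f(X)$ is defined by the spectral functional calculus, and $\lambda_1^\downarrow(X)\ge\lambda_2^\downarrow(X)\ge\cdots\ge\lambda_n^\downarrow(X)$ are the eigenvalues of $X$, counted with multiplicity, in non-increasing order. *)

theory Defs
  imports
    "HOL-Analysis.Convex"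
    "HOL-Library.Multiset"
    "HOL-Computational_Algebra.Polynomial"
    "Jordan_Normal_Form.Matrix"
    "Jordan_Normal_Form.Char_Poly"
    "Jordan_Normal_Form.Schur_Decomposition"
begin

definition hermitian_mat :: "complex mat \<Rightarrow> bool" where
  "hermitian_mat X \<longleftrightarrow> square_mat X \<and> mat_adjoint X = X"

definition unitary_mat :: "complex mat \<Rightarrow> bool" where
  "unitary_mat U \<longleftrightarrow> square_mat U \<and> inverts_mat U (mat_adjoint U) \<and> inverts_mat (mat_adjoint U) U"

definition psd_mat :: "complex mat \<Rightarrow> bool" where
  "psd_mat X \<longleftrightarrow> hermitian_mat X \<and> (\<forall>v \<in> carrier_vec (dim_row X). 0 \<le> Re ((X *\<^sub>v v) \<bullet>c v))"

text \<open>The order on matrices that the library provides is entrywise, hence a separate symbol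
  for the Loewner order.\<close>

definition loewner_ge :: "complex mat \<Rightarrow> complex mat \<Rightarrow> bool" (infix \<open>\<succeq>\<^sub>L\<close> 50) where
  "X \<succeq>\<^sub>L Y \<longleftrightarrow> psd_mat (X - Y)"

definition vec_l2norm :: "complex vec \<Rightarrow> real" where
  "vec_l2norm v = sqrt (Re (v \<bullet>c v))"

definition mat_opnorm :: "complex mat \<Rightarrow> real" where
  "mat_opnorm X = Sup {vec_l2norm (X *\<^sub>v v) | v. v \<in> carrier_vec (dim_col X) \<and> vec_l2norm v \<le> 1}"

text \<open>Spectral functional calculus: if \<open>X = U diag(d\<^sub>0, \<dots>, d\<^sub>n\<^sub>-\<^sub>1) U\<^sup>*\<close> with \<open>U\<close> unitary and all
  \<open>d\<^sub>i\<close> real, then \<open>f(X) = U diag(f(d\<^sub>0), \<dots>, f(d\<^sub>n\<^sub>-\<^sub>1)) U\<^sup>*\<close>. For Hermitian \<open>X\<close> such a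
  diagonalisation exists, and the resulting matrix does not depend on its choice.
  Unspecified for other \<open>X\<close>.\<close>

definition mat_fun :: "(real \<Rightarrow> real) \<Rightarrow> complex mat \<Rightarrow> complex mat" where
  "mat_fun f X = (THE Y. \<exists>U d. U \<in> carrier_mat (dim_row X) (dim_row X) \<and> unitary_mat U \<and>
      X = U * mat_diag (dim_row X) (\<lambda>i. complex_of_real (d i)) * mat_adjoint U \<and>
      Y = U * mat_diag (dim_row X) (\<lambda>i. complex_of_real (f (d i))) * mat_adjoint U)"

text \<open>The roots of the characteristic polynomial, repeated according to multiplicity and listed in
  non-increasing order. \<open>Re\<close> only changes the type, as eigenvalues of Hermitian matrices are real.\<close>

definition eigvals_desc :: "complex mat \<Rightarrow> real list" where
  "eigvals_desc X = rev (sorted_list_of_multiset (image_mset Re (proots (char_poly X))))"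

text \<open>Indexing starts at 1: \<open>eigval_desc 1 X\<close> is the largest eigenvalue.\<close>

definition eigval_desc :: "nat \<Rightarrow> complex mat \<Rightarrow> real" where
  "eigval_desc k X = eigvals_desc X ! (k - 1)"

end

(*
  Let b be the norm of B, so that the spectrum of A lies in [b, \<infinity>) and that of B in [0, b]. For every
  \<mu> \<ge> 0 there are c and m \<ge> 0 with f x \<ge> c + m x on [b, \<infinity>), f x \<le> m x on [0, b] and
  f \<mu> \<le> c + m \<mu>: for \<mu> \<le> b take the line through (0, 0) and (b, f b), for \<mu> > b a supporting line of
  f at \<mu>. Hence f(A) - f(B) \<ge> c I + m (A - B) in the Loewner order. If \<mu> is the k-th eigenvalue of
  A - B, then f \<mu> is that of f(A - B), and by Weyl monotonicity the k-th eigenvalue of f(A) - f(B) is at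
  least c + m \<mu> \<ge> f \<mu>.
*)
theory Submission
  imports Defs "HOL-Computational_Algebra.Fundamental_Theorem_Algebra"
begin

section \<open>Adjoints and unitary matrices\<close>

lemma mat_adjoint_dim [simp]:
  "dim_row (mat_adjoint A) = dim_col A" "dim_col (mat_adjoint A) = dim_row A"
  unfolding mat_adjoint_def by auto

lemma mat_adjoint_carrier [simp]:
  "A \<in> carrier_mat n m \<Longrightarrow> mat_adjoint A \<in> carrier_mat m n"
  by auto

lemma mat_adjoint_index [simp]:
  fixes A :: "complex mat"
  assumes "i < dim_col A" "j < dim_row A"
  shows "mat_adjoint A $$ (i,j) = cnj (A $$ (j,i))"
  using assms unfolding mat_adjoint_def by (auto simp: mat_of_rows_index)

lemma mat_adjoint_adjoint [simp]: "mat_adjoint (mat_adjoint A) = (A :: complex mat)"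
  by (intro eq_matI) auto

lemma mat_adjoint_mult:
  fixes A B :: "complex mat"
  assumes "dim_col A = dim_row B"
  shows "mat_adjoint (A * B) = mat_adjoint B * mat_adjoint A"
  using assms by (intro eq_matI) (auto simp: scalar_prod_def mult.commute)

lemma mat_diag_dims [simp]: "dim_row (mat_diag n g) = n" "dim_col (mat_diag n g) = n"
  unfolding mat_diag_def by auto

lemma mat_adjoint_mat_diag_real [simp]:
  "mat_adjoint (mat_diag n (\<lambda>i. complex_of_real (d i))) = mat_diag n (\<lambda>i. complex_of_real (d i))"
  by (intro eq_matI) (auto simp: mat_diag_def)

lemma unitary_matI:
  assumes "U \<in> carrier_mat n n" "mat_adjoint U * U = 1\<^sub>m n"
  shows "unitary_mat U"
proof -
  have "U * mat_adjoint U = 1\<^sub>m n"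
    using assms mat_mult_left_right_inverse[OF mat_adjoint_carrier] by blast
  then show ?thesis
    using assms unfolding unitary_mat_def inverts_mat_def by auto
qed

lemma unitary_matD:
  assumes "U \<in> carrier_mat n n" "unitary_mat U"
  shows "mat_adjoint U * U = 1\<^sub>m n" "U * mat_adjoint U = 1\<^sub>m n"
  using assms unfolding unitary_mat_def inverts_mat_def by auto

lemma unitary_mat_mult:
  assumes U: "U \<in> carrier_mat n n" "unitary_mat U" and V: "V \<in> carrier_mat n n" "unitary_mat V"
  shows "unitary_mat (U * V)"
proof (rule unitary_matI)
  note c = U(1) V(1) mat_adjoint_carrier[OF U(1)] mat_adjoint_carrier[OF V(1)]
  have "mat_adjoint (U * V) * (U * V) = mat_adjoint V * (mat_adjoint U * U * V)"
    using c by (simp add: mat_adjoint_mult assoc_mult_mat[of _ n n _ n _ n])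
  also have "\<dots> = 1\<^sub>m n"
    unfolding unitary_matD[OF U] using c unitary_matD[OF V] by simp
  finally show "mat_adjoint (U * V) * (U * V) = 1\<^sub>m n" .
qed (use U V in simp)

section \<open>Spectral theorem for Hermitian matrices\<close>

text \<open>Complete \<open>v\<close> to a basis, orthogonalise it and normalise. Gram-Schmidt
  leaves its first vector alone, so normalising is all that happens to \<open>v\<close>.\<close>

lemma exists_unitary_first_column:
  fixes v :: "complex vec"
  assumes v: "v \<in> carrier_vec n" and v0: "v \<noteq> 0\<^sub>v n"
  shows "\<exists>U c. U \<in> carrier_mat n n \<and> unitary_mat U \<and> col U 0 = c \<cdot>\<^sub>v v"
proof -
  have n: "n \<noteq> 0" using v v0 by auto
  interpret cof_vec_space n "TYPE(complex)" .
  define b where "b = basis_completion v"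
  define ws where "ws = gram_schmidt n b"
  from basis_completion[OF v v0, folded b_def]
  have dist_b: "distinct b" and indep: "\<not> lin_dep (set b)" and b: "set b \<subseteq> carrier_vec n"
    and hdb: "hd b = v" and len_b: "length b = n" by auto
  from hdb len_b n obtain vs where bv: "b = v # vs" by (cases b, auto)
  from gram_schmidt_result[OF b dist_b indep refl, folded ws_def]
  have ws: "set ws \<subseteq> carrier_vec n" "corthogonal ws" "length ws = n" by (auto simp: len_b)
  from gram_schmidt_hd[OF v, of vs, folded bv] have hdws: "hd ws = v" unfolding ws_def .
  define s where "s = (\<lambda>i. sqrt (Re (ws ! i \<bullet>c ws ! i)))"
  define U where "U = mat_of_cols n (map (\<lambda>i. complex_of_real (1 / s i) \<cdot>\<^sub>v ws ! i) [0..<n])"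
  have U: "U \<in> carrier_mat n n" unfolding U_def by auto
  have wsi: "ws ! i \<in> carrier_vec n" if "i < n" for i using that ws by auto
  have colU: "col U i = complex_of_real (1 / s i) \<cdot>\<^sub>v ws ! i" if "i < n" for i
    unfolding U_def using that wsi[OF that] by (subst col_mat_of_cols) auto
  \<comment> \<open>\<open>s i\<close> is the norm of \<open>ws ! i\<close>. The square of a vector
    is a non-negative complex number, hence equal to its real part.\<close>
  have s: "complex_of_real (s i) * complex_of_real (s i) = ws ! i \<bullet>c ws ! i \<and> s i \<noteq> 0" if "i < n" for i
  proof -
    have nz: "ws ! i \<bullet>c ws ! i \<noteq> 0" using corthogonalD[OF ws(2), of i i] that ws(3) by auto
    moreover have ge: "ws ! i \<bullet>c ws ! i \<ge> 0" by (rule conjugate_square_ge_0_vec)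
    ultimately have *: "Re (ws ! i \<bullet>c ws ! i) > 0" "Im (ws ! i \<bullet>c ws ! i) = 0"
      by (auto simp: less_eq_complex_def complex_eq_iff)
    then have "s i * s i = Re (ws ! i \<bullet>c ws ! i)" unfolding s_def by simp
    then have "complex_of_real (s i) * complex_of_real (s i) = complex_of_real (Re (ws ! i \<bullet>c ws ! i))"
      by (metis of_real_mult)
    then show ?thesis using * unfolding s_def by (auto simp: complex_eq_iff)
  qed
  have "mat_adjoint U * U = 1\<^sub>m n"
  proof (rule eq_matI)
    fix i j assume "i < dim_row (1\<^sub>m n :: complex mat)" "j < dim_col (1\<^sub>m n :: complex mat)"
    then have i: "i < n" and j: "j < n" by auto
    have "(mat_adjoint U * U) $$ (i,j) = conjugate (col U i) \<bullet> col U j"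
      using U i j mat_adjoint_carrier[OF U] unfolding mat_adjoint_def by simp
    also have "\<dots> = col U j \<bullet>c col U i"
      using U i j by (metis col_dim conjugate_vec_sprod_comm carrier_matD(1))
    also have "\<dots> = complex_of_real (1 / s j) * complex_of_real (1 / s i) * (ws ! j \<bullet>c ws ! i)"
      unfolding colU[OF i] colU[OF j] conjugate_smult_vec
      using wsi[OF i] wsi[OF j] by (simp add: scalar_prod_smult_distrib[of _ n])
    also have "\<dots> = (if i = j then 1 else 0)"
      using corthogonalD[OF ws(2), of j i] i j ws(3) s[OF i] by (auto simp: field_simps)
    finally show "(mat_adjoint U * U) $$ (i,j) = 1\<^sub>m n $$ (i,j)" using i j by simp
  qed (use U mat_adjoint_carrier[OF U] in auto)
  moreover have "col U 0 = complex_of_real (1 / s 0) \<cdot>\<^sub>v v"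
    using colU[of 0] hdws n ws(3) by (cases ws) auto
  ultimately show ?thesis using U unitary_matI[OF U] by blast
qed

lemma mat_adjoint_four_block:
  fixes A :: "complex mat"
  assumes "A \<in> carrier_mat a b" "D \<in> carrier_mat c d"
  shows "mat_adjoint (four_block_mat A (0\<^sub>m a d) (0\<^sub>m c b) D)
    = four_block_mat (mat_adjoint A) (0\<^sub>m b c) (0\<^sub>m d a) (mat_adjoint D)"
proof -
  show ?thesis using assms by (intro eq_matI) auto
qed

lemma block_diag_mult:
  fixes A :: "complex mat"
  assumes "A1 \<in> carrier_mat a a" "A2 \<in> carrier_mat a a" "D1 \<in> carrier_mat b b" "D2 \<in> carrier_mat b b"
  shows "four_block_mat A1 (0\<^sub>m a b) (0\<^sub>m b a) D1 * four_block_mat A2 (0\<^sub>m a b) (0\<^sub>m b a) D2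
    = four_block_mat (A1 * A2) (0\<^sub>m a b) (0\<^sub>m b a) (D1 * D2 :: complex mat)"
  using assms by (subst mult_four_block_mat[of _ a a _ b _ b]) auto

text \<open>The condition on \<open>X\<close> inside \<open>mat_fun\<close>, with the witnesses
  named: the columns of \<open>U\<close> are an orthonormal eigenbasis, and \<open>d\<close> lists
  the eigenvalues in any order.\<close>

definition spectral_decomp :: "nat \<Rightarrow> complex mat \<Rightarrow> complex mat \<Rightarrow> (nat \<Rightarrow> real) \<Rightarrow> bool" where
  "spectral_decomp n X U d \<longleftrightarrow> U \<in> carrier_mat n n \<and> unitary_mat U \<and>
     X = U * mat_diag n (\<lambda>i. complex_of_real (d i)) * mat_adjoint U"

text \<open>Inserting \<open>V * mat_adjoint V\<close>, the identity, on both sides of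
  \<open>X\<close> carries the eigenbasis back through \<open>V\<close> and keeps
  \<open>d\<close>.\<close>

lemma spectral_decomp_conj:
  assumes V: "V \<in> carrier_mat n n" "unitary_mat V" and X: "X \<in> carrier_mat n n"
    and S: "spectral_decomp n (mat_adjoint V * X * V) U d"
  shows "spectral_decomp n X (V * U) d"
proof -
  let ?D = "mat_diag n (\<lambda>i. complex_of_real (d i))"
  from S have U: "U \<in> carrier_mat n n" "unitary_mat U"
    and eq: "mat_adjoint V * X * V = U * ?D * mat_adjoint U"
    unfolding spectral_decomp_def by auto
  note V' = mat_adjoint_carrier[OF V(1)] and U' = mat_adjoint_carrier[OF U(1)]
  have "X = (V * mat_adjoint V) * X * (V * mat_adjoint V)" using unitary_matD[OF V] X by simp
  also have "\<dots> = V * (mat_adjoint V * X * V) * mat_adjoint V"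
    using X V(1) V' by (simp add: assoc_mult_mat[of _ n n _ n _ n] mult_carrier_mat[of _ n n _ n])
  also have "\<dots> = (V * U) * ?D * mat_adjoint (V * U)"
    unfolding eq
    using V(1) U(1) V' U' by (simp add: mat_adjoint_mult assoc_mult_mat[of _ n n _ n _ n] mult_carrier_mat[of _ n n _ n])
  finally show ?thesis using unitary_mat_mult[OF V U] V(1) U(1) unfolding spectral_decomp_def by simp
qed

text \<open>Deflation: in an orthonormal basis that starts with an eigenvector, the matrix splits
  into a 1 by 1 block and a smaller Hermitian block, to which the induction hypothesis
  applies.\<close>

theorem hermitian_spectral_decomp:
  assumes "X \<in> carrier_mat n n" "mat_adjoint X = X"
  shows "\<exists>U d. spectral_decomp n X U d"
  using assms
proof (induction n arbitrary: X)
  case 0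
  have "spectral_decomp 0 X (1\<^sub>m 0) (\<lambda>_. 0)"
    unfolding spectral_decomp_def
    by (intro conjI unitary_matI eq_matI) (use 0 in auto)
  then show ?case by blast
next
  case (Suc m)
  let ?n = "Suc m"
  from Suc.prems have X: "X \<in> carrier_mat ?n ?n" and herm: "mat_adjoint X = X" by auto
  have "degree (char_poly X) = ?n" using degree_monic_char_poly[OF X] by simp
  then have "\<not> constant (poly (char_poly X))" by (simp add: constant_degree)
  then obtain e where "poly (char_poly X) e = 0" using fundamental_theorem_of_algebra by blast
  then have "eigenvalue X e" using eigenvalue_root_char_poly[OF X] by simp
  then obtain v where v: "v \<in> carrier_vec ?n" "v \<noteq> 0\<^sub>v ?n" "X *\<^sub>v v = e \<cdot>\<^sub>v v"
    using X unfolding eigenvalue_def eigenvector_def by auto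
  obtain V c where V: "V \<in> carrier_mat ?n ?n" "unitary_mat V" and col: "col V 0 = c \<cdot>\<^sub>v v"
    using exists_unitary_first_column[OF v(1,2)] by blast
  note V' = mat_adjoint_carrier[OF V(1)]
  define Y where "Y = mat_adjoint V * X * V"
  have Y: "Y \<in> carrier_mat ?n ?n" unfolding Y_def using X V(1) V' by (simp add: mult_carrier_mat[of _ ?n ?n _ ?n])
  have Yh: "mat_adjoint Y = Y"
    unfolding Y_def using X V(1) V' herm
    by (simp add: mat_adjoint_mult assoc_mult_mat[of _ ?n ?n _ ?n _ ?n])
  have Ysym: "Y $$ (i,j) = cnj (Y $$ (j,i))" if "i < ?n" "j < ?n" for i j
    using mat_adjoint_index[of i Y j] that Y Yh by simp
  have colV: "col V 0 \<in> carrier_vec ?n" by (metis V(1) carrier_matD(1) col_dim)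
  \<comment> \<open>The first column of \<open>V\<close> is an eigenvector, and
    \<open>mat_adjoint V\<close> sends it to the first unit vector; so the first column of
    \<open>Y\<close> is \<open>e\<close> times that vector.\<close>
  have "col Y 0 = (mat_adjoint V * X) *\<^sub>v col V 0"
    unfolding Y_def using X V(1) V' by (simp add: col_mult2[of _ ?n ?n _ ?n] mult_carrier_mat[of _ ?n ?n _ ?n])
  also have "\<dots> = mat_adjoint V *\<^sub>v (X *\<^sub>v col V 0)"
    by (rule assoc_mult_mat_vec[OF V' X colV])
  also have "X *\<^sub>v col V 0 = e \<cdot>\<^sub>v col V 0"
    unfolding col using X v by (simp add: mult_mat_vec[of _ ?n ?n] smult_smult_assoc mult.commute)
  also have "mat_adjoint V *\<^sub>v (e \<cdot>\<^sub>v col V 0) = e \<cdot>\<^sub>v (mat_adjoint V *\<^sub>v col V 0)"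
    by (rule mult_mat_vec[OF V' colV])
  also have "mat_adjoint V *\<^sub>v col V 0 = col (1\<^sub>m ?n) 0"
    unfolding unitary_matD(1)[OF V, symmetric] using V(1) V' by (simp add: col_mult2[of _ ?n ?n _ ?n] mult_carrier_mat[of _ ?n ?n _ ?n])
  finally have colY: "col Y 0 = e \<cdot>\<^sub>v col (1\<^sub>m ?n) 0" .
  have Y0: "Y $$ (i,0) = (if i = 0 then e else 0)" if "i < ?n" for i
    using arg_cong[OF colY, of "\<lambda>w. w $ i"] that Y by simp
  \<comment> \<open>Hermitian symmetry clears the first row as well and makes the diagonal entry
    \<open>e\<close> real.\<close>
  have Y0': "Y $$ (0,i) = (if i = 0 then e else 0)" if "i < ?n" for i
    using Y0[of i] Y0[of 0] Ysym[of 0 i] that by auto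
  have "e = cnj e" using Ysym[of 0 0] Y0[of 0] by auto
  then have e: "complex_of_real (Re e) = e" by (auto simp: complex_eq_iff)
  define Z where "Z = mat m m (\<lambda>(i,j). Y $$ (Suc i, Suc j))"
  have Z: "Z \<in> carrier_mat m m" unfolding Z_def by simp
  have "mat_adjoint Z = Z"
    using Z
    by (intro eq_matI) (auto simp: Z_def Ysym[symmetric])
  from Suc.IH[OF Z this] obtain U d where U: "U \<in> carrier_mat m m" "unitary_mat U"
    and ZU: "Z = U * mat_diag m (\<lambda>i. complex_of_real (d i)) * mat_adjoint U"
    unfolding spectral_decomp_def by blast
  let ?b = "\<lambda>a D. four_block_mat a (0\<^sub>m 1 m) (0\<^sub>m m 1) D :: complex mat"
  \<comment> \<open>The diagonalisation of \<open>Z\<close> is bordered by 1, and \<open>d1\<close>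
    puts the eigenvalue \<open>e\<close> in front of \<open>d\<close>.\<close>
  define U1 where "U1 = ?b (1\<^sub>m 1) U"
  define d1 where "d1 = (\<lambda>i. case i of 0 \<Rightarrow> Re e | Suc j \<Rightarrow> d j)"
  note U' = mat_adjoint_carrier[OF U(1)]
  have one': "mat_adjoint (1\<^sub>m 1 :: complex mat) = 1\<^sub>m 1"
    using mat_adjoint_mat_diag_real[of 1 "\<lambda>_. 1"] by simp
  have U1: "U1 \<in> carrier_mat ?n ?n" unfolding U1_def using U(1) by auto
  have adj: "mat_adjoint U1 = ?b (1\<^sub>m 1) (mat_adjoint U)"
    unfolding U1_def by (subst mat_adjoint_four_block[OF _ U(1)]) (auto simp: one')
  have "mat_adjoint U1 * U1 = ?b (1\<^sub>m 1) (1\<^sub>m m)"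
    unfolding adj unfolding U1_def using U(1) U' unitary_matD[OF U]
    by (subst block_diag_mult) auto
  also have "\<dots> = 1\<^sub>m ?n" by (intro eq_matI) auto
  finally have unit: "unitary_mat U1" by (rule unitary_matI[OF U1])
  have D: "mat_diag ?n (\<lambda>i. complex_of_real (d1 i)) = ?b (mat 1 1 (\<lambda>_. e)) (mat_diag m (\<lambda>i. complex_of_real (d i)))"
    by (intro eq_matI) (auto simp: mat_diag_def d1_def e split: nat.split)
  have "Y = ?b (mat 1 1 (\<lambda>_. e)) Z"
  proof (rule eq_matI)
    fix i j assume "i < dim_row (?b (mat 1 1 (\<lambda>_. e)) Z)" "j < dim_col (?b (mat 1 1 (\<lambda>_. e)) Z)"
    then have "i < ?n" "j < ?n" using Z by auto
    then show "Y $$ (i,j) = ?b (mat 1 1 (\<lambda>_. e)) Z $$ (i,j)"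
      using Z Y0[of i] Y0'[of j] by (cases i; cases j) (auto simp: Z_def)
  qed (use Y Z in auto)
  also have "\<dots> = U1 * mat_diag ?n (\<lambda>i. complex_of_real (d1 i)) * mat_adjoint U1"
    unfolding adj unfolding U1_def D using U(1) U'
    by (subst block_diag_mult, auto, subst block_diag_mult, auto simp: ZU)
  finally have "spectral_decomp ?n Y U1 d1" unfolding spectral_decomp_def using U1 unit by simp
  from spectral_decomp_conj[OF V X this[unfolded Y_def]] show ?case by blast
qed

section \<open>Quadratic forms and norms in eigencoordinates\<close>

lemma cscalar_prod_mult_mat_vec:
  fixes M :: "complex mat"
  assumes M: "M \<in> carrier_mat n m" and v: "v \<in> carrier_vec m" and w: "w \<in> carrier_vec n"
  shows "(M *\<^sub>v v) \<bullet>c w = v \<bullet>c (mat_adjoint M *\<^sub>v w)"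
proof -
  have "(M *\<^sub>v v) \<bullet>c w = (\<Sum>i<n. \<Sum>j<m. M $$ (i,j) * v $ j * cnj (w $ i))"
    using assms by (simp add: scalar_prod_def sum_distrib_right lessThan_atLeast0)
  also have "\<dots> = (\<Sum>j<m. \<Sum>i<n. M $$ (i,j) * v $ j * cnj (w $ i))" by (rule sum.swap)
  also have "\<dots> = v \<bullet>c (mat_adjoint M *\<^sub>v w)"
    using assms by (simp add: scalar_prod_def sum_distrib_left lessThan_atLeast0 mult_ac)
  finally show ?thesis .
qed

lemma Re_cscalar_prod_self:
  "v \<in> carrier_vec n \<Longrightarrow> Re (v \<bullet>c v) = (\<Sum>i<n. (cmod (v $ i))\<^sup>2)"
  by (simp add: scalar_prod_def lessThan_atLeast0 complex_mult_cnj cmod_power2)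

lemma Re_cscalar_prod_self_pos:
  fixes v :: "complex vec"
  assumes "v \<in> carrier_vec n" "v \<noteq> 0\<^sub>v n"
  shows "Re (v \<bullet>c v) > 0"
proof -
  obtain i where "i < n" "v $ i \<noteq> 0" using assms by (metis eq_vecI carrier_vecD index_zero_vec)
  then have "0 < (\<Sum>i<n. (cmod (v $ i))\<^sup>2)" by (intro sum_pos2[of _ i]) auto
  then show ?thesis using Re_cscalar_prod_self[OF assms(1)] by simp
qed

lemma Re_cscalar_prod_minus_mat:
  fixes X Y :: "complex mat"
  assumes "X \<in> carrier_mat n n" "Y \<in> carrier_mat n n" "v \<in> carrier_vec n"
  shows "Re (((X - Y) *\<^sub>v v) \<bullet>c v) = Re ((X *\<^sub>v v) \<bullet>c v) - Re ((Y *\<^sub>v v) \<bullet>c v)"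
  using assms by (simp add: minus_mult_distrib_mat_vec[of _ n n] minus_scalar_prod_distrib[of _ n])

lemma spectral_decompD:
  assumes "spectral_decomp n X U d"
  shows "U \<in> carrier_mat n n" "unitary_mat U" "X \<in> carrier_mat n n"
    "X = U * mat_diag n (\<lambda>i. complex_of_real (d i)) * mat_adjoint U"
proof -
  show *: "U \<in> carrier_mat n n" "unitary_mat U"
    "X = U * mat_diag n (\<lambda>i. complex_of_real (d i)) * mat_adjoint U"
    using assms unfolding spectral_decomp_def by auto
  show "X \<in> carrier_mat n n" unfolding *(3) using *(1) by (simp add: mult_carrier_mat[of _ n n _ n])
qed

lemma spectral_decomp_adjoint:
  assumes "spectral_decomp n X U d"
  shows "mat_adjoint X = X"
  using spectral_decompD(1)[OF assms] unfolding spectral_decompD(4)[OF assms]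
  by (simp add: mat_adjoint_mult assoc_mult_mat[of _ n n _ n _ n] mult_carrier_mat[of _ n n _ n])

lemma mat_diag_mult_vec_index:
  assumes "w \<in> carrier_vec n" "i < n"
  shows "(mat_diag n g *\<^sub>v w) $ i = g i * (w $ i :: complex)"
proof -
  have "(\<Sum>j = 0..<n. (if i = j then g j else 0) * w $ j) = (\<Sum>j = 0..<n. if j = i then g i * w $ i else 0)"
    by (intro sum.cong) auto
  then show ?thesis using assms by (simp add: mat_diag_def scalar_prod_def)
qed

text \<open>Since \<open>mat_adjoint U * U\<close> is the identity, \<open>mat_adjoint U * X\<close>
  equals the diagonal matrix times \<open>mat_adjoint U\<close>.\<close>

lemma spectral_decomp_coords:
  assumes S: "spectral_decomp n X U d" and v: "v \<in> carrier_vec n" and i: "i < n"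
  shows "(mat_adjoint U *\<^sub>v (X *\<^sub>v v)) $ i = complex_of_real (d i) * (mat_adjoint U *\<^sub>v v) $ i"
proof -
  let ?D = "mat_diag n (\<lambda>i. complex_of_real (d i))"
  note U = spectral_decompD(1,2)[OF S]
  note U' = mat_adjoint_carrier[OF U(1)]
  have "mat_adjoint U * X = (mat_adjoint U * U) * ?D * mat_adjoint U"
    unfolding spectral_decompD(4)[OF S] using U(1) U'
    by (simp add: assoc_mult_mat[of _ n n _ n _ n] mult_carrier_mat[of _ n n _ n])
  also have "\<dots> = ?D * mat_adjoint U" unfolding unitary_matD[OF U] by (simp add: left_mult_one_mat[of _ n n])
  finally have "mat_adjoint U *\<^sub>v (X *\<^sub>v v) = ?D *\<^sub>v (mat_adjoint U *\<^sub>v v)"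
    using assoc_mult_mat_vec[OF U' spectral_decompD(3)[OF S] v] assoc_mult_mat_vec[OF _ U' v, of ?D n] by simp
  then show ?thesis using mat_diag_mult_vec_index[OF mult_mat_vec_carrier[OF U' v] i] by metis
qed

text \<open>Parseval's identity: move \<open>mat_adjoint U\<close> across the inner product and
  cancel it against \<open>U\<close>.\<close>

lemma unitary_mat_norm:
  assumes U: "U \<in> carrier_mat n n" "unitary_mat U" and v: "v \<in> carrier_vec n"
  shows "Re (v \<bullet>c v) = (\<Sum>i<n. (cmod ((mat_adjoint U *\<^sub>v v) $ i))\<^sup>2)"
proof -
  note U' = mat_adjoint_carrier[OF U(1)]
  note w = mult_mat_vec_carrier[OF U' v]
  have "(mat_adjoint U *\<^sub>v v) \<bullet>c (mat_adjoint U *\<^sub>v v) = v \<bullet>c (U *\<^sub>v (mat_adjoint U *\<^sub>v v))"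
    using cscalar_prod_mult_mat_vec[OF U' v w] by simp
  also have "U *\<^sub>v (mat_adjoint U *\<^sub>v v) = v"
    using assoc_mult_mat_vec[OF U(1) U' v] unitary_matD[OF U] v by simp
  finally show ?thesis using Re_cscalar_prod_self[OF w] by simp
qed

lemma spectral_decomp_quad:
  assumes S: "spectral_decomp n X U d" and v: "v \<in> carrier_vec n"
  shows "Re ((X *\<^sub>v v) \<bullet>c v) = (\<Sum>i<n. d i * (cmod ((mat_adjoint U *\<^sub>v v) $ i))\<^sup>2)"
proof -
  note U = spectral_decompD(1,2)[OF S]
  note U' = mat_adjoint_carrier[OF U(1)]
  note Xv = mult_mat_vec_carrier[OF spectral_decompD(3)[OF S] v]
  note w = mult_mat_vec_carrier[OF U' v] and w2 = mult_mat_vec_carrier[OF U' Xv]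
  have "U *\<^sub>v (mat_adjoint U *\<^sub>v (X *\<^sub>v v)) = X *\<^sub>v v"
    using assoc_mult_mat_vec[OF U(1) U' Xv] unitary_matD[OF U] Xv by simp
  then have "(X *\<^sub>v v) \<bullet>c v = (mat_adjoint U *\<^sub>v (X *\<^sub>v v)) \<bullet>c (mat_adjoint U *\<^sub>v v)"
    using cscalar_prod_mult_mat_vec[OF U(1) w2 v] by simp
  also have "\<dots> = (\<Sum>i<n. complex_of_real (d i) * (mat_adjoint U *\<^sub>v v) $ i * cnj ((mat_adjoint U *\<^sub>v v) $ i))"
    using w spectral_decomp_coords[OF S v] U(1)
    unfolding scalar_prod_def by (auto simp: lessThan_atLeast0 intro!: sum.cong)
  also have "\<dots> = (\<Sum>i<n. complex_of_real (d i * (cmod ((mat_adjoint U *\<^sub>v v) $ i))\<^sup>2))"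
    by (intro sum.cong) (auto simp: complex_norm_square mult.assoc simp del: of_real_power)
  finally show ?thesis by simp
qed

lemma unitary_mat_inverse_vec:
  assumes "U \<in> carrier_mat n n" "unitary_mat U" "w \<in> carrier_vec n"
  shows "mat_adjoint U *\<^sub>v (U *\<^sub>v w) = w"
  using assoc_mult_mat_vec[OF mat_adjoint_carrier[OF assms(1)] assms(1,3)] unitary_matD[OF assms(1,2)] assms(3)
  by simp

text \<open>Column \<open>i\<close> of \<open>U\<close> has the i-th unit vector as coordinates.
  Used as a test vector, it turns bounds on a quadratic form into bounds on the single eigenvalue
  \<open>d i\<close>.\<close>

lemma unitary_mat_unit_vec:
  assumes U: "U \<in> carrier_mat n n" "unitary_mat U" and i: "i < n"
  defines "u \<equiv> U *\<^sub>v unit_vec n i"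
  shows "u \<in> carrier_vec n" "Re (u \<bullet>c u) = 1"
    "(\<Sum>j<n. g j * (cmod ((mat_adjoint U *\<^sub>v u) $ j))\<^sup>2) = g i"
proof -
  show u: "u \<in> carrier_vec n" unfolding u_def using U by simp
  show *: "(\<Sum>j<n. g j * (cmod ((mat_adjoint U *\<^sub>v u) $ j))\<^sup>2) = g i" for g :: "nat \<Rightarrow> real"
  proof -
    have "(\<Sum>j<n. g j * (cmod ((mat_adjoint U *\<^sub>v u) $ j))\<^sup>2) = (\<Sum>j<n. if j = i then g i else 0)"
      unfolding u_def unitary_mat_inverse_vec[OF U unit_vec_carrier] using i
      by (intro sum.cong) (auto simp: unit_vec_def)
    then show ?thesis using i by simp
  qed
  show "Re (u \<bullet>c u) = 1" using unitary_mat_norm[OF U u] *[of "\<lambda>_. 1"] by simp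
qed

text \<open>The i-th eigenvector has norm 1 and is stretched by the absolute value of
  \<open>d i\<close>. For the supremum to dominate this value, the set in \<open>mat_opnorm\<close>
  must be shown bounded.\<close>

lemma spectral_decomp_abs_le_opnorm:
  assumes S: "spectral_decomp n X U d" and i: "i < n"
  shows "\<bar>d i\<bar> \<le> mat_opnorm X"
proof -
  note U = spectral_decompD(1,2)[OF S] and X = spectral_decompD(3)[OF S]
  let ?w = "\<lambda>v j. (cmod ((mat_adjoint U *\<^sub>v v) $ j))\<^sup>2"
  have nX: "Re ((X *\<^sub>v v) \<bullet>c (X *\<^sub>v v)) = (\<Sum>j<n. (d j)\<^sup>2 * ?w v j)" if "v \<in> carrier_vec n" for v
    unfolding unitary_mat_norm[OF U mult_mat_vec_carrier[OF X that]]
    by (intro sum.cong) (auto simp: spectral_decomp_coords[OF S that] norm_mult power_mult_distrib)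
  define u where "u = U *\<^sub>v unit_vec n i"
  note u = unitary_mat_unit_vec[OF U i, folded u_def]
  have "vec_l2norm (X *\<^sub>v u) = \<bar>d i\<bar>"
    unfolding vec_l2norm_def nX[OF u(1)] u(3) by simp
  moreover have "vec_l2norm (X *\<^sub>v u) \<le> mat_opnorm X"
    unfolding mat_opnorm_def
  proof (rule cSup_upper)
    show "vec_l2norm (X *\<^sub>v u) \<in> {vec_l2norm (X *\<^sub>v v) |v. v \<in> carrier_vec (dim_col X) \<and> vec_l2norm v \<le> 1}"
      using u X by (auto simp: vec_l2norm_def)
    show "bdd_above {vec_l2norm (X *\<^sub>v v) |v. v \<in> carrier_vec (dim_col X) \<and> vec_l2norm v \<le> 1}"
    proof (rule bdd_aboveI, safe)
      fix v assume "v \<in> carrier_vec (dim_col X)" and n1: "vec_l2norm v \<le> 1"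
      then have v: "v \<in> carrier_vec n" using X by simp
      have "Re (v \<bullet>c v) \<le> 1" using n1 unfolding vec_l2norm_def by simp
      then have "(\<Sum>j<n. ?w v j) \<le> 1" unfolding unitary_mat_norm[OF U v] .
      \<comment> \<open>The squared coordinates sum to at most 1, so each is at most 1; a crude
        bound on the stretched norm is enough.\<close>
      then have "?w v j \<le> 1" if "j < n" for j
        using member_le_sum[of j "{..<n}" "?w v"] that by force
      then have "(\<Sum>j<n. (d j)\<^sup>2 * ?w v j) \<le> (\<Sum>j<n. (d j)\<^sup>2)"
        by (intro sum_mono) (simp add: mult_left_le)
      then show "vec_l2norm (X *\<^sub>v v) \<le> sqrt (\<Sum>j<n. (d j)\<^sup>2)"
        unfolding vec_l2norm_def nX[OF v] by simp
    qed
  qed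
  ultimately show ?thesis by simp
qed

section \<open>Functional calculus\<close>

text \<open>The change of basis \<open>W\<close> intertwines the two diagonal matrices, so its entry
  at \<open>(i,j)\<close> vanishes unless \<open>d j = e i\<close>. Hence \<open>W\<close> also
  intertwines their images under \<open>f\<close>.\<close>

lemma spectral_decomp_functional_unique:
  assumes S: "spectral_decomp n X U d" and T: "spectral_decomp n X V e"
  shows "U * mat_diag n (\<lambda>i. complex_of_real (f (d i))) * mat_adjoint U
    = V * mat_diag n (\<lambda>i. complex_of_real (f (e i))) * mat_adjoint V"
proof -
  let ?D = "\<lambda>d. mat_diag n (\<lambda>i. complex_of_real (d i))"
  note U = spectral_decompD(1,2)[OF S] and V = spectral_decompD(1,2)[OF T] and X = spectral_decompD(3)[OF S]
  note U' = mat_adjoint_carrier[OF U(1)] and V' = mat_adjoint_carrier[OF V(1)]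
  note assoc = assoc_mult_mat[of _ n n _ n _ n] mult_carrier_mat[of _ n n _ n]
  define W where "W = mat_adjoint V * U"
  have W: "W \<in> carrier_mat n n" unfolding W_def using U V' by simp
  have "mat_adjoint V * X * U = W * ?D d * (mat_adjoint U * U)"
    unfolding spectral_decompD(4)[OF S] W_def using U(1) U' V' by (simp add: assoc)
  also have "\<dots> = W * ?D d" unfolding unitary_matD[OF U] using W by (simp add: assoc right_mult_one_mat[of _ n n])
  finally have 1: "mat_adjoint V * X * U = W * ?D d" .
  have "mat_adjoint V * X * U = (mat_adjoint V * V) * ?D e * W"
    unfolding spectral_decompD(4)[OF T] W_def using U(1) U' V(1) V' by (simp add: assoc)
  also have "\<dots> = ?D e * W" unfolding unitary_matD[OF V] using W by (simp add: assoc)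
  finally have eq: "W * ?D d = ?D e * W" using 1 by simp
  have "W * ?D (f \<circ> d) = ?D (f \<circ> e) * W"
  proof (rule eq_matI)
    fix i j assume "i < dim_row (?D (f \<circ> e) * W)" "j < dim_col (?D (f \<circ> e) * W)"
    then have ij: "i < n" "j < n" using W by (auto simp: mat_diag_def)
    have "W $$ (i,j) * complex_of_real (d j) = complex_of_real (e i) * W $$ (i,j)"
      using arg_cong[OF eq, of "\<lambda>M. M $$ (i,j)"] ij
      by (simp add: mat_diag_mult_left[OF W] mat_diag_mult_right[OF W])
    then have "W $$ (i,j) = 0 \<or> d j = e i" by (auto simp: mult.commute)
    then show "(W * ?D (f \<circ> d)) $$ (i,j) = (?D (f \<circ> e) * W) $$ (i,j)"
      using ij by (auto simp: mat_diag_mult_left[OF W] mat_diag_mult_right[OF W])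
  qed (use W in \<open>auto simp: mat_diag_def\<close>)
  then have fW: "W * ?D (\<lambda>i. f (d i)) = ?D (\<lambda>i. f (e i)) * W" by (simp add: o_def)
  have "U * ?D (\<lambda>i. f (d i)) * mat_adjoint U = (V * mat_adjoint V) * U * ?D (\<lambda>i. f (d i)) * mat_adjoint U"
    unfolding unitary_matD[OF V] using U by simp
  also have "\<dots> = V * (W * ?D (\<lambda>i. f (d i))) * mat_adjoint U"
    unfolding W_def using U(1) U' V(1) V' by (simp add: assoc)
  also have "\<dots> = V * ?D (\<lambda>i. f (e i)) * mat_adjoint V * (U * mat_adjoint U)"
    unfolding fW unfolding W_def using U(1) U' V(1) V' by (simp add: assoc)
  also have "\<dots> = V * ?D (\<lambda>i. f (e i)) * mat_adjoint V"
    unfolding unitary_matD[OF U] using V(1) V' by (simp add: assoc)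
  finally show ?thesis .
qed

text \<open>Uniqueness resolves the definite description in \<open>mat_fun\<close>; the eigenbasis
  stays the same and \<open>f\<close> acts on the eigenvalues.\<close>

lemma spectral_decomp_mat_fun:
  assumes S: "spectral_decomp n X U d"
  shows "spectral_decomp n (mat_fun f X) U (\<lambda>i. f (d i))"
proof -
  note U = spectral_decompD(1,2)[OF S]
  have dim: "dim_row X = n" using spectral_decompD(3)[OF S] by simp
  have "mat_fun f X = U * mat_diag n (\<lambda>i. complex_of_real (f (d i))) * mat_adjoint U"
    unfolding mat_fun_def dim
  proof (rule the_equality)
    fix Y assume "\<exists>U d. U \<in> carrier_mat n n \<and> unitary_mat U \<and>
        X = U * mat_diag n (\<lambda>i. complex_of_real (d i)) * mat_adjoint U \<and>
        Y = U * mat_diag n (\<lambda>i. complex_of_real (f (d i))) * mat_adjoint U"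
    then obtain V e where "spectral_decomp n X V e"
      and "Y = V * mat_diag n (\<lambda>i. complex_of_real (f (e i))) * mat_adjoint V"
      unfolding spectral_decomp_def by blast
    then show "Y = U * mat_diag n (\<lambda>i. complex_of_real (f (d i))) * mat_adjoint U"
      using spectral_decomp_functional_unique[OF S] by metis
  qed (use S in \<open>auto simp: spectral_decomp_def\<close>)
  then show ?thesis using U unfolding spectral_decomp_def by simp
qed

section \<open>Sorted eigenvalues by counting\<close>

text \<open>\<open>X\<close> is similar to its diagonal form, so its characteristic polynomial is
  the product of the linear factors with roots \<open>d i\<close>.\<close>

lemma mset_eigvals_desc:
  assumes S: "spectral_decomp n X U d"
  shows "mset (eigvals_desc X) = image_mset d (mset_set {..<n})"
proof -
  let ?D = "mat_diag n (\<lambda>i. complex_of_real (d i))"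
  note U = spectral_decompD(1,2)[OF S]
  have "similar_mat_wit X ?D U (mat_adjoint U)"
    unfolding similar_mat_wit_def Let_def
    using spectral_decompD(3,4)[OF S] U unitary_matD[OF U] by auto
  then have "char_poly X = char_poly ?D" by (intro char_poly_similar) (auto simp: similar_mat_def)
  also have "\<dots> = (\<Prod>a\<leftarrow>diag_mat ?D. [:- a, 1:])"
    by (rule char_poly_upper_triangular[of _ n]) (auto simp: mat_diag_def)
  also have "diag_mat ?D = map (\<lambda>i. complex_of_real (d i)) [0..<n]"
    by (auto simp: diag_mat_def mat_diag_def)
  finally have cp: "char_poly X = (\<Prod>a\<leftarrow>map (\<lambda>i. complex_of_real (d i)) [0..<n]. [:- a, 1:])" .
  have pr: "proots (\<Prod>a\<leftarrow>as. [:- a, 1:]) = mset as" for as :: "complex list"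
  proof (induction as)
    case (Cons a as)
    have "(\<Prod>a\<leftarrow>as. [:- a, 1:]) \<noteq> 0" by (auto simp: prod_list_zero_iff)
    then show ?case using Cons by (simp add: proots_mult del: mult_pCons_left)
  qed simp
  have "image_mset Re (proots (char_poly X)) = mset (map d [0..<n])"
    unfolding cp pr by (simp add: multiset.map_comp o_def)
  then show ?thesis unfolding eigvals_desc_def by (simp add: lessThan_atLeast0)
qed

text \<open>In a non-increasing list the entries that are at least \<nu> form a prefix.\<close>

lemma le_nth_iff_le_length_filter:
  fixes xs :: "'a::linorder list"
  assumes "sorted_wrt (\<ge>) xs" "i < length xs"
  shows "\<nu> \<le> xs ! i \<longleftrightarrow> i < length (filter (\<lambda>x. \<nu> \<le> x) xs)"
proof -
  have split: "length (filter P xs) = length (filter P (take m xs)) + length (filter P (drop m xs))" for P m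
    by (metis append_take_drop_id filter_append length_append)
  show ?thesis
  proof
    assume le: "\<nu> \<le> xs ! i"
    have "\<nu> \<le> x" if "x \<in> set (take (Suc i) xs)" for x
    proof -
      from that obtain j where "j \<le> i" "x = xs ! j" by (auto simp: in_set_conv_nth less_Suc_eq_le)
      then show ?thesis using assms le sorted_wrt_nth_less[OF assms(1), of j i]
        by (cases "j = i") auto
    qed
    then have "length (filter (\<lambda>x. \<nu> \<le> x) (take (Suc i) xs)) = Suc i" using assms(2) by (simp add: min_def)
    then show "i < length (filter (\<lambda>x. \<nu> \<le> x) xs)"
      using split[of _ "Suc i"] by simp
  next
    assume lt: "i < length (filter (\<lambda>x. \<nu> \<le> x) xs)"
    show "\<nu> \<le> xs ! i"
    proof (rule ccontr)
      assume n: "\<not> \<nu> \<le> xs ! i"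
      have "\<not> \<nu> \<le> x" if x: "x \<in> set (drop i xs)" for x
      proof -
        from x obtain j where "i + j < length xs" "x = xs ! (i + j)"
          using assms(2) by (auto simp: in_set_conv_nth add.commute less_diff_conv)
        then show ?thesis using n sorted_wrt_nth_less[OF assms(1), of i "i + j"]
          by (cases "j = 0") auto
      qed
      then have "length (filter (\<lambda>x. \<nu> \<le> x) (drop i xs)) = 0" by (auto simp: filter_empty_conv)
      moreover have "length (filter (\<lambda>x. \<nu> \<le> x) (take i xs)) \<le> i"
        using length_filter_le[of _ "take i xs"] assms(2) by (metis le_trans length_take min.cobounded2)
      ultimately show False
        using lt split[of _ i] by simp
    qed
  qed
qed

text \<open>Reduces statements on the k-th largest eigenvalue to cardinalities of index sets, so
  that \<open>d\<close> never has to be sorted.\<close>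

lemma le_eigval_desc_iff:
  assumes S: "spectral_decomp n X U d" and k: "k \<in> {1..n}"
  shows "\<nu> \<le> eigval_desc k X \<longleftrightarrow> k \<le> card {i. i < n \<and> \<nu> \<le> d i}"
proof -
  let ?L = "eigvals_desc X"
  note m = mset_eigvals_desc[OF S]
  have len: "length ?L = n" using arg_cong[OF m, of size] by simp
  have "sorted_wrt (\<ge>) ?L" unfolding eigvals_desc_def
    by (simp add: sorted_wrt_rev sorted_sorted_list_of_multiset)
  moreover have "length (filter (\<lambda>x. \<nu> \<le> x) ?L) = size (filter_mset (\<lambda>x. \<nu> \<le> x) (mset ?L))"
    by (simp flip: mset_filter)
  moreover have "\<dots> = card {i. i < n \<and> \<nu> \<le> d i}"
    unfolding m by (simp add: filter_mset_image_mset filter_mset_mset_set)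
  ultimately have "\<nu> \<le> ?L ! (k - 1) \<longleftrightarrow> k - 1 < card {i. i < n \<and> \<nu> \<le> d i}"
    using le_nth_iff_le_length_filter[of ?L "k - 1" \<nu>] k len by auto
  then show ?thesis unfolding eigval_desc_def using k by auto
qed

section \<open>Comparison of eigenvalue counts by dimension\<close>

lemma underdetermined_system:
  fixes ws :: "complex vec list"
  assumes ws: "set ws \<subseteq> carrier_vec n" and len: "length ws < n"
  shows "\<exists>v \<in> carrier_vec n. v \<noteq> 0\<^sub>v n \<and> (\<forall>w \<in> set ws. w \<bullet> v = 0)"
proof -
  define c where "c = (\<lambda>i. if i < length ws then ws ! i else 0\<^sub>v n)"
  have c: "c i \<in> carrier_vec n" for i using ws unfolding c_def by auto
  \<comment> \<open>The equations are padded with zero rows to a square matrix. Row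
    \<open>length ws\<close> is zero and lies inside the matrix, which is therefore
    singular.\<close>
  define M where "M = mat\<^sub>r n n (\<lambda>i. if i = length ws then 0\<^sub>v n else c i)"
  have M: "M \<in> carrier_mat n n" unfolding M_def by simp
  have "det M = 0" unfolding M_def by (rule det_row_0[OF len]) (use c in auto)
  then obtain v where v: "v \<in> carrier_vec n" "v \<noteq> 0\<^sub>v n" "M *\<^sub>v v = 0\<^sub>v n"
    using det_0_iff_vec_prod_zero_field[OF M] by blast
  have "w \<bullet> v = 0" if "w \<in> set ws" for w
  proof -
    from that obtain i where i: "i < length ws" "w = ws ! i" by (auto simp: in_set_conv_nth)
    have "row M i = w" unfolding M_def using i len c[of i] by (subst row_mat_of_row_fun) (auto simp: c_def)
    then show ?thesis using arg_cong[OF v(3), of "\<lambda>u. u $ i"] i len M by simp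
  qed
  then show ?thesis using v by blast
qed

text \<open>Support in \<open>I\<close> costs \<open>n - card I\<close> linear equations and
  vanishing on \<open>J\<close> costs \<open>card J\<close>; together these are fewer than
  \<open>n\<close>.\<close>

lemma exists_vec_supported_vanishing:
  fixes W :: "complex mat"
  assumes W: "W \<in> carrier_mat n n" and I: "I \<subseteq> {..<n}" and J: "J \<subseteq> {..<n}" and less: "card J < card I"
  shows "\<exists>y \<in> carrier_vec n. y \<noteq> 0\<^sub>v n \<and> (\<forall>i<n. i \<notin> I \<longrightarrow> y $ i = 0) \<and> (\<forall>j\<in>J. (W *\<^sub>v y) $ j = 0)"
proof -
  have fin: "finite I" "finite J" using I J finite_subset by auto
  have cI: "card I \<le> n" using card_mono[OF _ I] by simp
  define ws where "ws = map (row W) (sorted_list_of_set J)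
    @ map (unit_vec n) (sorted_list_of_set ({..<n} - I))"
  have "length ws = card J + (n - card I)"
    unfolding ws_def using card_Diff_subset[OF fin(1) I] by simp
  then have "length ws < n" using less cI by simp
  moreover have "set ws \<subseteq> carrier_vec n" using W fin J row_carrier[of W] unfolding ws_def by auto
  ultimately obtain y where y: "y \<in> carrier_vec n" "y \<noteq> 0\<^sub>v n" "\<forall>w \<in> set ws. w \<bullet> y = 0"
    using underdetermined_system by blast
  have "y $ i = 0" if "i < n" "i \<notin> I" for i
  proof -
    have "unit_vec n i \<bullet> y = 0" using y(3) that unfolding ws_def by auto
    then show ?thesis using y(1) that(1) by simp
  qed
  moreover have "(W *\<^sub>v y) $ j = 0" if "j \<in> J" for j
  proof -
    have "row W j \<bullet> y = 0" using y(3) that fin unfolding ws_def by auto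
    then show ?thesis using that J W by auto
  qed
  ultimately show ?thesis using y by blast
qed

text \<open>A count of dimensions as for the Courant--Fischer theorem: otherwise some nonzero vector is a
  combination of the eigenvectors of \<open>X\<close> for the indices \<open>i\<close> with \<open>\<mu> \<le> d i\<close> and is orthogonal to
  those of \<open>Y\<close> for the \<open>j\<close> with \<open>c + m * \<mu> \<le> e j\<close>.\<close>

lemma spectral_decomp_card_mono:
  assumes S: "spectral_decomp n X U d" and T: "spectral_decomp n Y V e"
    and ge: "\<And>v. v \<in> carrier_vec n \<Longrightarrow>
      c * Re (v \<bullet>c v) + m * Re ((X *\<^sub>v v) \<bullet>c v) \<le> Re ((Y *\<^sub>v v) \<bullet>c v)"
    and m: "m \<ge> 0"
  shows "card {i. i < n \<and> \<mu> \<le> d i} \<le> card {j. j < n \<and> c + m * \<mu> \<le> e j}"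
proof (rule ccontr)
  let ?I = "{i. i < n \<and> \<mu> \<le> d i}" and ?J = "{j. j < n \<and> c + m * \<mu> \<le> e j}"
  assume "\<not> card ?I \<le> card ?J"
  then have less: "card ?J < card ?I" by simp
  note U = spectral_decompD(1,2)[OF S] and V = spectral_decompD(1,2)[OF T]
  note V' = mat_adjoint_carrier[OF V(1)]
  \<comment> \<open>This matrix turns coordinates in the eigenbasis of \<open>X\<close> into
    coordinates in that of \<open>Y\<close>. Below, \<open>y\<close> and \<open>z\<close> are the
    two coordinate vectors of the same \<open>x\<close>.\<close>
  have W: "mat_adjoint V * U \<in> carrier_mat n n" using U(1) V' by simp
  obtain y where y: "y \<in> carrier_vec n" "y \<noteq> 0\<^sub>v n" "\<And>i. i < n \<Longrightarrow> i \<notin> ?I \<Longrightarrow> y $ i = 0"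
    "\<And>j. j \<in> ?J \<Longrightarrow> ((mat_adjoint V * U) *\<^sub>v y) $ j = 0"
    using exists_vec_supported_vanishing[OF W _ _ less] by blast
  define x where "x = U *\<^sub>v y"
  have x: "x \<in> carrier_vec n" unfolding x_def using U(1) y(1) by simp
  have Ux: "mat_adjoint U *\<^sub>v x = y" unfolding x_def by (rule unitary_mat_inverse_vec[OF U y(1)])
  define z where "z = mat_adjoint V *\<^sub>v x"
  have zJ: "z $ j = 0" if "j \<in> ?J" for j
    unfolding z_def x_def assoc_mult_mat_vec[OF V' U(1) y(1), symmetric] by (rule y(4)[OF that])
  note nU = unitary_mat_norm[OF U x, unfolded Ux] and nV = unitary_mat_norm[OF V x, folded z_def]
  note qX = spectral_decomp_quad[OF S x, unfolded Ux] and qY = spectral_decomp_quad[OF T x, folded z_def]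
  have pos: "Re (x \<bullet>c x) > 0"
    using Re_cscalar_prod_self_pos[OF y(1,2)] Re_cscalar_prod_self[OF y(1)] nU by simp
  have "\<mu> * Re (x \<bullet>c x) \<le> Re ((X *\<^sub>v x) \<bullet>c x)"
    unfolding nU qX sum_distrib_left
  proof (rule sum_mono)
    fix i assume "i \<in> {..<n}"
    then show "\<mu> * (cmod (y $ i))\<^sup>2 \<le> d i * (cmod (y $ i))\<^sup>2"
      using y(3)[of i] by (cases "i \<in> ?I") (auto intro: mult_right_mono)
  qed
  then have "m * (\<mu> * Re (x \<bullet>c x)) \<le> m * Re ((X *\<^sub>v x) \<bullet>c x)" using m by (rule mult_left_mono)
  then have "(c + m * \<mu>) * Re (x \<bullet>c x) \<le> Re ((Y *\<^sub>v x) \<bullet>c x)"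
    using ge[OF x] by (simp add: algebra_simps)
  moreover have "Re ((Y *\<^sub>v x) \<bullet>c x) < (c + m * \<mu>) * Re (x \<bullet>c x)"
  proof -
    \<comment> \<open>Strictness needs one nonzero coordinate; its index is outside
      \<open>?J\<close>, so its eigenvalue is strictly below the threshold.\<close>
    have "\<exists>j<n. z $ j \<noteq> 0"
    proof (rule ccontr)
      assume "\<not> (\<exists>j<n. z $ j \<noteq> 0)"
      then have "Re (x \<bullet>c x) = 0" unfolding nV by simp
      with pos show False by simp
    qed
    then obtain j where j: "j < n" "z $ j \<noteq> 0" by blast
    have "e i * (cmod (z $ i))\<^sup>2 \<le> (c + m * \<mu>) * (cmod (z $ i))\<^sup>2" if "i < n" for i
      using zJ[of i] that by (cases "i \<in> ?J") (auto intro: mult_right_mono)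
    moreover have "e j < c + m * \<mu>" using zJ[of j] j by force
    then have "e j * (cmod (z $ j))\<^sup>2 < (c + m * \<mu>) * (cmod (z $ j))\<^sup>2"
      using j by (intro mult_strict_right_mono) auto
    ultimately show ?thesis
      unfolding nV qY sum_distrib_left using j(1) by (intro sum_strict_mono_ex1) auto
  qed
  ultimately show False by simp
qed

section \<open>Parallel lines bounding a convex function\<close>

text \<open>The lower bound will be applied to the eigenvalues of \<open>A\<close> and the upper
  bound to those of \<open>B\<close>. Their common slope \<open>m\<close> lets the two combine into
  a bound in terms of \<open>A - B\<close>.\<close>

lemma convex_on_exists_minorant:
  fixes f :: "real \<Rightarrow> real"
  assumes conv: "convex_on {0..} f" and f0: "f 0 = 0" and nonneg: "\<And>x. x \<ge> 0 \<Longrightarrow> f x \<ge> 0"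
    and b: "b \<ge> 0" and \<mu>: "\<mu> \<ge> 0"
  shows "\<exists>c m. m \<ge> 0 \<and> (\<forall>x\<ge>b. c + m * x \<le> f x) \<and> (\<forall>x. 0 \<le> x \<longrightarrow> x \<le> b \<longrightarrow> f x \<le> m * x)
    \<and> f \<mu> \<le> c + m * \<mu>"
proof -
  \<comment> \<open>As \<open>f 0 = 0\<close>, convexity makes \<open>f x / x\<close>
    non-decreasing; the product form also covers zero.\<close>
  have chord: "y * f x \<le> x * f y" if "0 \<le> x" "x \<le> y" for x y
  proof (cases "y = 0")
    case False
    have "f x \<le> x / y * f y"
      using convex_onD[OF conv, of "x / y" 0 y] False that f0 by simp
    then show ?thesis using False that by (simp add: field_simps)
  qed (use that in simp)
  show ?thesis
  proof (cases "\<mu> \<le> b")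
    case True
    \<comment> \<open>Slope of the chord from 0 to \<open>b\<close>, with \<open>c = 0\<close>. For
      \<open>b = 0\<close> division yields \<open>m = 0\<close>, and then both \<open>x\<close> in
      the upper bound and \<mu> are 0.\<close>
    define m where "m = f b / b"
    have "m \<ge> 0" using nonneg[OF b] b unfolding m_def by simp
    moreover have "m * x \<le> f x" if "x \<ge> b" for x
      using chord[OF b that] nonneg[of x] that b by (cases "b = 0") (auto simp: m_def field_simps)
    moreover have "f x \<le> m * x" if "0 \<le> x" "x \<le> b" for x
      using chord[OF that] that f0 by (cases "b = 0") (auto simp: m_def field_simps)
    ultimately show ?thesis using True \<mu> by (intro exI[of _ 0] exI[of _ m]) auto
  next
    case False
    then have \<mu>0: "\<mu> > 0" using b by simp
    let ?Q = "\<lambda>y. (f y - f \<mu>) / (y - \<mu>)"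
    \<comment> \<open>The right derivative of \<open>f\<close> at \<mu>. It lies between all secant
      slopes to the left and all those to the right of \<mu>, so the line through
      \<open>(\<mu>, f \<mu>)\<close> with this slope supports \<open>f\<close>.\<close>
    define m where "m = (INF y\<in>{\<mu><..}. ?Q y)"
    have sl: "(f \<mu> - f x) / (\<mu> - x) \<le> ?Q y" if "0 \<le> x" "x < \<mu>" "\<mu> < y" for x y
      using convex_on_slope_le[OF conv, of x y \<mu>] that minus_divide_divide[of "f x - f \<mu>" "x - \<mu>"]
        minus_divide_divide[of "f \<mu> - f y" "\<mu> - y"] by simp
    have below: "(f \<mu> - f x) / (\<mu> - x) \<le> m" if "0 \<le> x" "x < \<mu>" for x
      unfolding m_def using sl[OF that] by (intro cINF_greatest) auto
    have above: "m \<le> ?Q y" if "y > \<mu>" for y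
      unfolding m_def using that sl[of 0] \<mu>0 by (intro cINF_lower bdd_belowI2) auto
    \<comment> \<open>The secant from 0 is at most as steep as the supporting line. This gives both
      \<open>m \<ge> 0\<close> and the upper bound on \<open>[0, b]\<close>.\<close>
    have m\<mu>: "f \<mu> / \<mu> \<le> m" using below[of 0] \<mu>0 f0 by simp
    then have m0: "m \<ge> 0" using nonneg[of \<mu>] \<mu>0 by (meson divide_nonneg_pos less_imp_le order_trans)
    have "f \<mu> - m * \<mu> + m * x \<le> f x" if "x \<ge> 0" for x
    proof (cases x \<mu> rule: linorder_cases)
      case less
      then show ?thesis using below[OF that less] by (simp add: field_simps)
    next
      case greater
      then show ?thesis using above[OF greater] by (simp add: field_simps)
    qed simp
    moreover have "f x \<le> m * x" if "0 \<le> x" "x \<le> b" for x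
    proof -
      have "f x \<le> f \<mu> / \<mu> * x" using chord[of x \<mu>] that False \<mu>0 by (simp add: field_simps)
      also have "\<dots> \<le> m * x" using m\<mu> that by (intro mult_right_mono) auto
      finally show ?thesis .
    qed
    ultimately show ?thesis using m0 b by (intro exI[of _ "f \<mu> - m * \<mu>"] exI[of _ m]) auto
  qed
qed

section \<open>From scalar bounds to the eigenvalue inequality\<close>

theorem corollary1:
  fixes f :: "real \<Rightarrow> real" and n :: nat and A B :: "complex mat"
  assumes f_nonneg: "\<And>x. x \<ge> 0 \<Longrightarrow> f x \<ge> 0"
    and f_strict_mono: "strict_mono_on {0..} f"
    and f_convex: "convex_on {0..} f"
    and f_zero: "f 0 = 0"
    and A_dim: "A \<in> carrier_mat n n"
    and B_dim: "B \<in> carrier_mat n n"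
    and A_psd: "psd_mat A"
    and B_psd: "psd_mat B"
    and A_ge: "A \<succeq>\<^sub>L complex_of_real (mat_opnorm B) \<cdot>\<^sub>m 1\<^sub>m n"
  shows "\<forall>k \<in> {1..n}. eigval_desc k (mat_fun f (A - B)) \<le> eigval_desc k (mat_fun f A - mat_fun f B)"
proof
  fix k assume k: "k \<in> {1..n}"
  define b where "b = mat_opnorm B"
  have AB: "A - B \<in> carrier_mat n n" by (rule minus_carrier_mat[OF B_dim])
  have hermA: "mat_adjoint A = A" and hermB: "mat_adjoint B = B"
    using A_psd B_psd unfolding psd_mat_def hermitian_mat_def by auto
  obtain UA a where SA: "spectral_decomp n A UA a"
    using hermitian_spectral_decomp[OF A_dim hermA] by blast
  obtain UB \<beta> where SB: "spectral_decomp n B UB \<beta>"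
    using hermitian_spectral_decomp[OF B_dim hermB] by blast
  have adj_minus: "mat_adjoint (X - Y) = mat_adjoint X - mat_adjoint Y"
    if "X \<in> carrier_mat n n" "Y \<in> carrier_mat n n" for X Y :: "complex mat"
    using that by (intro eq_matI) auto
  obtain U d where S: "spectral_decomp n (A - B) U d"
    using hermitian_spectral_decomp[OF AB] adj_minus[OF A_dim B_dim] hermA hermB by auto
  note fA = spectral_decomp_mat_fun[OF SA, of f] and fB = spectral_decomp_mat_fun[OF SB, of f]
  have H: "mat_fun f A - mat_fun f B \<in> carrier_mat n n" by (rule minus_carrier_mat[OF spectral_decompD(3)[OF fB]])
  obtain V e where T: "spectral_decomp n (mat_fun f A - mat_fun f B) V e"
    using hermitian_spectral_decomp[OF H] adj_minus[OF spectral_decompD(3)[OF fA] spectral_decompD(3)[OF fB]]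
      spectral_decomp_adjoint[OF fA] spectral_decomp_adjoint[OF fB] by auto
  have qA: "b * Re (v \<bullet>c v) \<le> Re ((A *\<^sub>v v) \<bullet>c v)" if v: "v \<in> carrier_vec n" for v
  proof -
    have "(complex_of_real b \<cdot>\<^sub>m 1\<^sub>m n) *\<^sub>v v = complex_of_real b \<cdot>\<^sub>v v"
      using v by (intro eq_vecI) auto
    then show ?thesis
      using A_ge v Re_cscalar_prod_minus_mat[OF A_dim _ v, of "complex_of_real b \<cdot>\<^sub>m 1\<^sub>m n"]
      unfolding loewner_ge_def psd_mat_def b_def[symmetric] by auto
  qed
  have a: "b \<le> a i" if "i < n" for i
    using qA[OF unitary_mat_unit_vec(1)[OF spectral_decompD(1,2)[OF SA] that]]
      spectral_decomp_quad[OF SA unitary_mat_unit_vec(1)[OF spectral_decompD(1,2)[OF SA] that]]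
      unitary_mat_unit_vec(2,3)[OF spectral_decompD(1,2)[OF SA] that] by simp
  have \<beta>0: "0 \<le> \<beta> i" if "i < n" for i
    using B_psd B_dim spectral_decomp_quad[OF SB unitary_mat_unit_vec(1)[OF spectral_decompD(1,2)[OF SB] that]]
      unitary_mat_unit_vec(1,3)[OF spectral_decompD(1,2)[OF SB] that] unfolding psd_mat_def by auto
  have \<beta>b: "\<beta> i \<le> b" if "i < n" for i
    using spectral_decomp_abs_le_opnorm[OF SB that] unfolding b_def by simp
  \<comment> \<open>The range of \<open>k\<close> forces \<open>n\<close> to be positive, so that
    index 0 exists.\<close>
  have b0: "b \<ge> 0" using \<beta>0[of 0] \<beta>b[of 0] k by auto
  have qB: "Re ((B *\<^sub>v v) \<bullet>c v) \<le> b * Re (v \<bullet>c v)" if v: "v \<in> carrier_vec n" for v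
    unfolding spectral_decomp_quad[OF SB v] unitary_mat_norm[OF spectral_decompD(1,2)[OF SB] v] sum_distrib_left
    using \<beta>b by (intro sum_mono mult_right_mono) auto
  \<comment> \<open>The form of \<open>A\<close> is at least \<open>b\<close> times the squared norm
    and that of \<open>B\<close> at most this, so \<open>A - B\<close> is positive
    semidefinite.\<close>
  have d0: "0 \<le> d i" if "i < n" for i
  proof -
    note u = unitary_mat_unit_vec[OF spectral_decompD(1,2)[OF S] that]
    show ?thesis
      using qA[OF u(1)] qB[OF u(1)] Re_cscalar_prod_minus_mat[OF A_dim B_dim u(1)]
        spectral_decomp_quad[OF S u(1)] u(3) by simp
  qed
  define \<nu> where "\<nu> = eigval_desc k (mat_fun f (A - B))"
  define I where "I = {i. i < n \<and> \<nu> \<le> f (d i)}"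
  have cI: "k \<le> card I"
    using le_eigval_desc_iff[OF spectral_decomp_mat_fun[OF S, of f] k, of \<nu>] unfolding I_def \<nu>_def by simp
  then have I: "finite I" "I \<noteq> {}" using k card_gt_0_iff[of I] by auto
  \<comment> \<open>At least \<open>k\<close> eigenvalues of \<open>A - B\<close> have an image
    under \<open>f\<close> that is at least \<nu>. Their minimum \<mu> is attained, so
    \<open>\<nu> \<le> f \<mu>\<close>, and at least \<open>k\<close> eigenvalues are at least
    \<mu>.\<close>
  define \<mu> where "\<mu> = Min (d ` I)"
  have "\<mu> \<in> d ` I" unfolding \<mu>_def using I by (intro Min_in) auto
  then have \<mu>: "\<mu> \<ge> 0" "\<nu> \<le> f \<mu>" using d0 unfolding I_def by auto
  obtain c m where m: "m \<ge> 0" and up: "\<And>x. b \<le> x \<Longrightarrow> c + m * x \<le> f x"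
    and lo: "\<And>x. 0 \<le> x \<Longrightarrow> x \<le> b \<Longrightarrow> f x \<le> m * x" and f\<mu>: "f \<mu> \<le> c + m * \<mu>"
    using convex_on_exists_minorant[OF f_convex f_zero f_nonneg b0 \<mu>(1)] by blast
  \<comment> \<open>The scalar bounds are summed with squared coordinates as weights, for
    \<open>A\<close> and \<open>B\<close> each in its own eigenbasis; no commutation is
    required.\<close>
  have "c * Re (v \<bullet>c v) + m * Re (((A - B) *\<^sub>v v) \<bullet>c v) \<le> Re (((mat_fun f A - mat_fun f B) *\<^sub>v v) \<bullet>c v)"
    if v: "v \<in> carrier_vec n" for v
  proof -
    have "c * Re (v \<bullet>c v) + m * Re ((A *\<^sub>v v) \<bullet>c v) \<le> Re ((mat_fun f A *\<^sub>v v) \<bullet>c v)"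
      unfolding spectral_decomp_quad[OF SA v] spectral_decomp_quad[OF fA v]
        unitary_mat_norm[OF spectral_decompD(1,2)[OF SA] v] sum_distrib_left sum.distrib[symmetric]
        mult.assoc[symmetric] distrib_right[symmetric]
      using up a by (intro sum_mono mult_right_mono) auto
    moreover have "Re ((mat_fun f B *\<^sub>v v) \<bullet>c v) \<le> m * Re ((B *\<^sub>v v) \<bullet>c v)"
      unfolding spectral_decomp_quad[OF SB v] spectral_decomp_quad[OF fB v] sum_distrib_left
        mult.assoc[symmetric]
      using lo \<beta>0 \<beta>b by (intro sum_mono mult_right_mono) auto
    ultimately show ?thesis
      unfolding Re_cscalar_prod_minus_mat[OF A_dim B_dim v]
        Re_cscalar_prod_minus_mat[OF spectral_decompD(3)[OF fA] spectral_decompD(3)[OF fB] v]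
      by (simp add: algebra_simps)
  qed
  from spectral_decomp_card_mono[OF S T this m, of \<mu>]
  have "card {i. i < n \<and> \<mu> \<le> d i} \<le> card {j. j < n \<and> c + m * \<mu> \<le> e j}" .
  moreover have "card I \<le> card {i. i < n \<and> \<mu> \<le> d i}"
    using I unfolding \<mu>_def by (intro card_mono) (auto simp: I_def)
  ultimately have "c + m * \<mu> \<le> eigval_desc k (mat_fun f A - mat_fun f B)"
    using le_eigval_desc_iff[OF T k] cI by simp
  then show "eigval_desc k (mat_fun f (A - B)) \<le> eigval_desc k (mat_fun f A - mat_fun f B)"
    using \<mu>(2) f\<mu> unfolding \<nu>_def by simp
qed

end
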